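(* Let $n\ge1$ and let $(\xi_i,\mathcal{F}_i)_{i=0,\dots,n}$ be real-valued supermartingale differences with $S_k=\sum_{i=1}^k\xi_i$ and $[S]_k=\sum_{i=1}^k\xi_i^2$. Assume $\xi_i\ge-1$ for all $i\in[1,n]$. Then, for all $x,v>0$, $$\mathbf{P}\left(S_k\ge x\ \text{and}\ [S]_k\le v^2\ \text{for some}\ k\in[1,n]\right)\le\left(1+\frac{x}{v^2}\right)^{v^2}e^{-x}\le B_1(x,1,v)\le B_2(x,1,v).$$
   Context: $(\xi_i,\mathcal{F}_i)_{i=0,\dots,n}$ is a sequence of real-valued supermartingale differences on a probability space $(\Omega,\mathcal{F},\mathbf{P})$: $\xi_0=0$, $\{\emptyset,\Omega\}=\mathcal{F}_0\subseteq\dots\subseteq\mathcal{F}_n\subseteq\mathcal{F}$ are increasing $\sigma$-fields, $\xi_i$ is $\mathcal{F}_i$-measurable, and $\mathbf{E}(\xi_i|\mathcal{F}_{i-1})\le 0$ for $i=1,\dots,n$. Here $i,k\in[1,n]$ denote integers. For $x,\epsilon,v>0$, $$B_1(x,\epsilon,v)=\exp\left\{-\frac{x^2}{v^2\left(1+\sqrt{1+2x\epsilon/v^2}\right)+x\epsilon}\right\},\qquad B_2(x,\epsilon,v)=\exp\left\{-\frac{x^2}{2(v^2+x\epsilon)}\right\}.$$ *)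

theory Defs
  imports "HOL-Probability.Probability"
begin

text \<open>
  The integrability assumption is what gives the conditional expectation its usual meaning:
  \<open>real_cond_exp\<close> is a total function whose value is junk where the conditional expectation
  of the positive or negative part is infinite. Only indices up to \<open>n\<close> are constrained.
\<close>

locale supermartingale_differences = prob_space M
  for M :: "'a measure" +
  fixes F :: "nat \<Rightarrow> 'a measure" and \<xi> :: "nat \<Rightarrow> 'a \<Rightarrow> real" and n :: nat
  assumes subalg: "\<And>i. i \<le> n \<Longrightarrow> subalgebra M (F i)"
    and sets_mono: "\<And>i j. i \<le> j \<Longrightarrow> j \<le> n \<Longrightarrow> sets (F i) \<subseteq> sets (F j)"
    and sets_0: "sets (F 0) = {{}, space M}"
    and adapted: "\<And>i. i \<le> n \<Longrightarrow> \<xi> i \<in> borel_measurable (F i)"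
    and xi_0: "\<And>\<omega>. \<omega> \<in> space M \<Longrightarrow> \<xi> 0 \<omega> = 0"
    and integrable_xi: "\<And>i. i \<in> {1..n} \<Longrightarrow> integrable M (\<xi> i)"
    and cond_exp_nonpos:
      "\<And>i. i \<in> {1..n} \<Longrightarrow> AE \<omega> in M. real_cond_exp M (F (i - 1)) (\<xi> i) \<omega> \<le> 0"

definition partial_sum :: "(nat \<Rightarrow> 'a \<Rightarrow> real) \<Rightarrow> nat \<Rightarrow> 'a \<Rightarrow> real" where
  "partial_sum \<xi> k \<omega> = (\<Sum>i = 1..k. \<xi> i \<omega>)"

definition quad_var :: "(nat \<Rightarrow> 'a \<Rightarrow> real) \<Rightarrow> nat \<Rightarrow> 'a \<Rightarrow> real" where
  "quad_var \<xi> k \<omega> = (\<Sum>i = 1..k. (\<xi> i \<omega>)\<^sup>2)"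

definition B1 :: "real \<Rightarrow> real \<Rightarrow> real \<Rightarrow> real" where
  "B1 x \<epsilon> v = exp (- (x\<^sup>2 / (v\<^sup>2 * (1 + sqrt (1 + 2 * x * \<epsilon> / v\<^sup>2)) + x * \<epsilon>)))"

definition B2 :: "real \<Rightarrow> real \<Rightarrow> real \<Rightarrow> real" where
  "B2 x \<epsilon> v = exp (- (x\<^sup>2 / (2 * (v\<^sup>2 + x * \<epsilon>))))"

end

theory Submission
  imports Defs
begin

text \<open>
  For \<open>0 < l < 1\<close> put \<open>p = - l - ln (1 - l)\<close>. Since \<open>(ln (1 + t) - t) / t\<^sup>2\<close> is increasing, every
  \<open>y \<ge> - 1\<close> satisfies \<open>exp (l y - p y\<^sup>2) \<le> 1 + l y\<close>. Hence \<open>exp (l S\<^sub>k - p [S]\<^sub>k)\<close> is a supermartingale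
  whose factors are bounded; stopping it when it first reaches \<open>exp (l x - p v\<^sup>2)\<close> and applying
  Markov's inequality bounds the probability by \<open>exp (p v\<^sup>2 - l x)\<close>, and \<open>l = x / (v\<^sup>2 + x)\<close> is the
  optimal choice. The comparison with \<open>B1\<close> reduces to \<open>1 + t + t\<^sup>2 / 2 \<le> exp t\<close> at
  \<open>t = sqrt (1 + 2 x / v\<^sup>2) - 1\<close>.
\<close>

section \<open>Scalar inequalities for one increment\<close>

lemma ln_one_minus_le_quadratic:
  fixes l :: real
  assumes "0 \<le> l" "l < 1"
  shows "ln (1 - l) \<le> - l - l\<^sup>2 / 2"
proof -
  define g where "g = (\<lambda>z::real. - z - z\<^sup>2 / 2 - ln (1 - z))"
  have "\<exists>d. (g has_real_derivative d) (at z) \<and> 0 \<le> d" if "0 \<le> z" "z \<le> l" for z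
  proof -
    have "(g has_real_derivative (- 1 - z + 1 / (1 - z))) (at z)"
      unfolding g_def using that assms by (auto intro!: derivative_eq_intros)
    moreover have "- 1 - z + 1 / (1 - z) = z\<^sup>2 / (1 - z)"
      using that assms by (simp add: field_simps power2_eq_square)
    ultimately show ?thesis using that assms by (metis diff_ge_0_iff_ge divide_nonneg_nonneg
          less_eq_real_def order_trans zero_le_power2)
  qed
  from DERIV_nonneg_imp_nondecreasing[OF \<open>0 \<le> l\<close> this] have "g 0 \<le> g l" by blast
  then show ?thesis by (simp add: g_def)
qed

text \<open>In logarithmic form the claim is \<open>0 \<le> h y\<close>. The coefficient
  \<open>p\<close> is chosen so that \<open>h\<close> vanishes at both 0 and -1. Since
  \<open>h' z = z * q z\<close> with \<open>q\<close> increasing, \<open>h'\<close> can change sign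
  on [-1, 0] only from nonnegative to nonpositive, so \<open>h\<close> stays above its zero endpoint
  values there.\<close>

lemma exp_linear_minus_quadratic_le:
  fixes l y :: real
  assumes l: "0 < l" "l < 1" and y: "- 1 \<le> y"
  shows "exp (l * y - (- l - ln (1 - l)) * y\<^sup>2) \<le> 1 + l * y"
proof -
  define p where "p = - l - ln (1 - l)"
  \<comment> \<open>This says \<open>0 \<le> q 0\<close>; monotonicity of \<open>q\<close> then
    makes \<open>h\<close> nondecreasing to the right of 0.\<close>
  have p: "l\<^sup>2 \<le> 2 * p"
    using ln_one_minus_le_quadratic[of l] l by (simp add: p_def)
  have pos: "0 < 1 + l * z" if "- 1 \<le> z" for z
  proof -
    have "l * (- 1) \<le> l * z" using that l by (intro mult_left_mono) auto
    then show ?thesis using l by simp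
  qed
  define h where "h = (\<lambda>z. ln (1 + l * z) - l * z + p * z\<^sup>2)"
  define q where "q = (\<lambda>z. 2 * p - l\<^sup>2 / (1 + l * z))"
  have deriv: "(h has_real_derivative z * q z) (at z)" if "- 1 \<le> z" for z
  proof -
    have "(h has_real_derivative (l / (1 + l * z) - l + 2 * p * z)) (at z)"
      unfolding h_def using pos[OF that] by (auto intro!: derivative_eq_intros)
    moreover have "l / (1 + l * z) - l + 2 * p * z = z * q z"
      using pos[OF that] by (simp add: q_def field_simps power2_eq_square)
    ultimately show ?thesis by simp
  qed
  have q_mono: "q z \<le> q w" if "- 1 \<le> z" "z \<le> w" for z w
  proof -
    have "l * z \<le> l * w" using that l by simp
    then have "l\<^sup>2 / (1 + l * w) \<le> l\<^sup>2 / (1 + l * z)"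
      using pos[of z] that by (intro divide_left_mono mult_pos_pos pos) auto
    then show ?thesis by (simp add: q_def)
  qed
  have h0: "h 0 = 0" and h1: "h (- 1) = 0" by (auto simp: h_def p_def)
  have "0 \<le> h y"
  proof (cases "0 \<le> y")
    case True
    have "h 0 \<le> h y"
    proof (rule DERIV_nonneg_imp_nondecreasing[OF True])
      fix z assume z: "0 \<le> z" "z \<le> y"
      have "0 \<le> q z" using q_mono[of 0 z] p z by (simp add: q_def)
      then show "\<exists>d. (h has_real_derivative d) (at z) \<and> 0 \<le> d"
        using deriv[of z] z by (intro exI[of _ "z * q z"]) auto
    qed
    then show ?thesis using h0 by simp
  next
    case neg: False
    show ?thesis
    \<comment> \<open>The sign of \<open>q y\<close> decides which zero to compare with: if
      \<open>q y \<le> 0\<close>, then \<open>h\<close> is nondecreasing on [-1, y]; otherwise it is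
      nonincreasing on [y, 0].\<close>
    proof (cases "q y \<le> 0")
      case True
      have "h (- 1) \<le> h y"
      proof (rule DERIV_nonneg_imp_nondecreasing[OF y])
        fix z assume z: "- 1 \<le> z" "z \<le> y"
        have "q z \<le> 0" using q_mono[OF z] True by simp
        then show "\<exists>d. (h has_real_derivative d) (at z) \<and> 0 \<le> d"
          using deriv[of z] z neg by (intro exI[of _ "z * q z"]) (auto intro: mult_nonpos_nonpos)
      qed
      then show ?thesis using h1 by simp
    next
      case False
      have "y \<le> 0" using neg by simp
      then have "h y \<ge> h 0"
      proof (rule DERIV_nonpos_imp_nonincreasing)
        fix z assume z: "y \<le> z" "z \<le> 0"
        have "0 \<le> q z" using q_mono[OF y z(1)] False by simp
        then show "\<exists>d. (h has_real_derivative d) (at z) \<and> d \<le> 0"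
          using deriv[of z] z y by (intro exI[of _ "z * q z"]) (auto intro: mult_nonpos_nonneg)
      qed
      then show ?thesis using h0 by simp
    qed
  qed
  then have "l * y - p * y\<^sup>2 \<le> ln (1 + l * y)" by (simp add: h_def)
  then have "exp (l * y - p * y\<^sup>2) \<le> 1 + l * y"
    using pos[OF y] by (simp add: ln_ge_iff)
  then show ?thesis by (simp add: p_def)
qed

section \<open>Maximal inequality for products of bounded factors\<close>

context supermartingale_differences
begin

text \<open>The weight \<open>G\<close> is known one step before \<open>\<xi> i\<close>, so inside
  the integral \<open>\<xi> i\<close> may be replaced by its conditional expectation, which is
  nonpositive. The bound \<open>C\<close> supplies integrability through domination by
  \<open>C * \<xi> i\<close>.\<close>

lemma integral_mult_xi_nonpos:
  assumes i: "i \<in> {1..n}" and G: "G \<in> borel_measurable (F (i - 1))"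
    and bnd: "\<And>\<omega>. 0 \<le> G \<omega>" "\<And>\<omega>. G \<omega> \<le> C"
  shows "integrable M (\<lambda>\<omega>. G \<omega> * \<xi> i \<omega>)" and "(\<integral>\<omega>. G \<omega> * \<xi> i \<omega> \<partial>M) \<le> 0"
proof -
  have sub: "subalgebra M (F (i - 1))" using i by (intro subalg) auto
  then interpret S: finite_measure_subalgebra M "F (i - 1)" by unfold_locales
  have GM[measurable]: "G \<in> borel_measurable M" using measurable_from_subalg[OF sub G] .
  have xM[measurable]: "\<xi> i \<in> borel_measurable M" using integrable_xi[OF i] by auto
  show int: "integrable M (\<lambda>\<omega>. G \<omega> * \<xi> i \<omega>)"
  proof (rule Bochner_Integration.integrable_bound)
    show "integrable M (\<lambda>\<omega>. C * \<xi> i \<omega>)" using integrable_xi[OF i] by simp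
    show "AE \<omega> in M. norm (G \<omega> * \<xi> i \<omega>) \<le> norm (C * \<xi> i \<omega>)"
      using bnd by (auto simp: abs_mult intro!: AE_I2 mult_right_mono)
        (meson abs_ge_self bnd order_trans)
  qed measurable
  have "AE \<omega> in M. 0 \<le> - (G \<omega> * real_cond_exp M (F (i - 1)) (\<xi> i) \<omega>)"
    using cond_exp_nonpos[OF i] by eventually_elim (use bnd in \<open>simp add: mult_nonneg_nonpos\<close>)
  then have "0 \<le> (\<integral>\<omega>. - (G \<omega> * real_cond_exp M (F (i - 1)) (\<xi> i) \<omega>) \<partial>M)"
    by (rule integral_nonneg_AE)
  then show "(\<integral>\<omega>. G \<omega> * \<xi> i \<omega> \<partial>M) \<le> 0"
    using S.real_cond_exp_intg(2)[OF int G xM] by simp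
qed

end

text \<open>The running product of the \<open>U i\<close>, frozen from the first time it is at least
  \<open>a\<close>. Freezing turns a crossing at some time into an event about the last value
  alone.\<close>

primrec stopped_prod :: "real \<Rightarrow> (nat \<Rightarrow> 'a \<Rightarrow> real) \<Rightarrow> nat \<Rightarrow> 'a \<Rightarrow> real" where
  "stopped_prod a U 0 = (\<lambda>\<omega>. 1)"
| "stopped_prod a U (Suc k) =
    (\<lambda>\<omega>. if a \<le> stopped_prod a U k \<omega> then stopped_prod a U k \<omega>
         else stopped_prod a U k \<omega> * U (Suc k) \<omega>)"

lemma stopped_prod_stays:
  assumes "a \<le> stopped_prod a U k \<omega>" "k \<le> m"
  shows "a \<le> stopped_prod a U m \<omega>"
  using assms(2,1) by (induction rule: dec_induct) auto

lemma stopped_prod_eq_or_ge: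
  "stopped_prod a U k \<omega> = (\<Prod>i = 1..k. U i \<omega>) \<or> a \<le> stopped_prod a U k \<omega>"
  by (induction k) auto

lemma stopped_prod_ge:
  assumes "a \<le> (\<Prod>i = 1..k. U i \<omega>)" "k \<le> m"
  shows "a \<le> stopped_prod a U m \<omega>"
  using stopped_prod_stays stopped_prod_eq_or_ge assms by metis

lemma stopped_prod_bounds:
  assumes "\<And>i. 0 \<le> U i \<omega>" "\<And>i. U i \<omega> \<le> C" "1 \<le> C"
  shows "0 \<le> stopped_prod a U k \<omega> \<and> stopped_prod a U k \<omega> \<le> C ^ k"
proof (induction k)
  case (Suc k)
  have "stopped_prod a U k \<omega> * c \<le> C ^ k * C" if "0 \<le> c" "c \<le> C" for c
    using Suc that assms(3) by (intro mult_mono) auto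
  from this[of 1] this[of "U (Suc k) \<omega>"] show ?case
    using Suc assms by (auto simp: mult.commute)
qed simp

context supermartingale_differences
begin

text \<open>The bound \<open>1 + l * \<xi> i\<close> on each factor keeps the expectation of the
  stopped product at most 1. Its value at time \<open>n\<close> is at least \<open>a\<close>
  whenever some partial product was, so Markov's inequality at time \<open>n\<close>
  suffices.\<close>

lemma ville_maximal_inequality_prod:
  fixes U :: "nat \<Rightarrow> 'a \<Rightarrow> real"
  assumes meas: "\<And>i. i \<in> {1..n} \<Longrightarrow> U i \<in> borel_measurable (F i)"
    and bnd: "\<And>i \<omega>. 0 \<le> U i \<omega>" "\<And>i \<omega>. U i \<omega> \<le> C"
    and le: "\<And>i. i \<in> {1..n} \<Longrightarrow> AE \<omega> in M. U i \<omega> \<le> 1 + l * \<xi> i \<omega>"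
    and "0 \<le> l" "0 < a"
  shows "prob {\<omega> \<in> space M. \<exists>k\<in>{1..n}. a \<le> (\<Prod>i = 1..k. U i \<omega>)} \<le> 1 / a"
proof -
  let ?W = "stopped_prod a U"
  define D where "D = max 1 C"
  have bW: "0 \<le> ?W k \<omega>" "?W k \<omega> \<le> D ^ k" for k \<omega>
    using stopped_prod_bounds[of U \<omega> D a k] bnd by (auto simp: D_def le_max_iff_disj)
  have mW: "?W k \<in> borel_measurable (F k)" if "k \<le> n" for k
    using that
  proof (induction k)
    case (Suc k)
    have "subalgebra (F (Suc k)) (F k)"
      using sets_mono[of k "Suc k"] subalg[of k] subalg[of "Suc k"] Suc.prems
      by (auto simp: subalgebra_def)
    then have [measurable]: "?W k \<in> borel_measurable (F (Suc k))"
      using Suc measurable_from_subalg by auto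
    have [measurable]: "U (Suc k) \<in> borel_measurable (F (Suc k))" using meas Suc.prems by auto
    show ?case by simp
  qed simp
  have mWM: "?W k \<in> borel_measurable M" if "k \<le> n" for k
    using measurable_from_subalg[OF subalg mW] that by blast
  have iW: "integrable M (?W k)" if "k \<le> n" for k
    using bW mWM[OF that] by (intro integrable_const_bound[where B = "D ^ k"]) auto
  have EW: "(\<integral>\<omega>. ?W k \<omega> \<partial>M) \<le> 1" if "k \<le> n" for k
    using that
  proof (induction k)
    case 0
    then show ?case by (simp add: prob_space)
  next
    case (Suc k)
    \<comment> \<open>\<open>G\<close> is the current value while the product is running and 0 once
      it is frozen, so one formula bounds the next value in both cases, with a weight that is known
      at time \<open>k\<close>.\<close>
    define G where "G = (\<lambda>\<omega>. if a \<le> ?W k \<omega> then 0 else ?W k \<omega>)"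
    have i: "Suc k \<in> {1..n}" using Suc.prems by simp
    have "?W k \<in> borel_measurable (F (Suc k - 1))" using mW Suc.prems by simp
    then have mG: "G \<in> borel_measurable (F (Suc k - 1))"
      unfolding G_def by measurable
    have bG: "0 \<le> G \<omega>" "G \<omega> \<le> D ^ k" for \<omega>
      using bW[of k \<omega>] by (auto simp: G_def)
    note Gxi = integral_mult_xi_nonpos[OF i mG bG]
    have "AE \<omega> in M. ?W (Suc k) \<omega> \<le> ?W k \<omega> + l * (G \<omega> * \<xi> (Suc k) \<omega>)"
      using le[OF i]
    proof eventually_elim
      case (elim \<omega>)
      have "?W k \<omega> * U (Suc k) \<omega> \<le> ?W k \<omega> * (1 + l * \<xi> (Suc k) \<omega>)"
        using elim bW by (intro mult_left_mono) auto
      then show ?case by (simp add: G_def algebra_simps)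
    qed
    then have "(\<integral>\<omega>. ?W (Suc k) \<omega> \<partial>M) \<le> (\<integral>\<omega>. ?W k \<omega> + l * (G \<omega> * \<xi> (Suc k) \<omega>) \<partial>M)"
      using iW[of k] iW[OF Suc.prems] Gxi(1) Suc.prems by (intro integral_mono_AE) auto
    also have "\<dots> = (\<integral>\<omega>. ?W k \<omega> \<partial>M) + l * (\<integral>\<omega>. G \<omega> * \<xi> (Suc k) \<omega> \<partial>M)"
      using iW[of k] Gxi(1) Suc.prems by simp
    also have "\<dots> \<le> 1"
      using Suc Gxi(2) mult_nonneg_nonpos[OF \<open>0 \<le> l\<close> Gxi(2)] by simp
    finally show ?case .
  qed
  have [measurable]: "?W n \<in> borel_measurable M" using mWM by simp
  have "prob {\<omega> \<in> space M. \<exists>k\<in>{1..n}. a \<le> (\<Prod>i = 1..k. U i \<omega>)}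
      \<le> prob {\<omega> \<in> space M. a \<le> ?W n \<omega>}"
    by (intro finite_measure_mono) (auto intro: stopped_prod_ge)
  also have "\<dots> \<le> (\<integral>\<omega>. ?W n \<omega> \<partial>M) / a"
    using iW bW \<open>0 < a\<close> by (intro integral_Markov_inequality_measure[where A = "{}"]) auto
  also have "\<dots> \<le> 1 / a"
    using EW \<open>0 < a\<close> by (intro divide_right_mono) auto
  finally show ?thesis .
qed

lemma prob_partial_sum_ge_quad_var_le:
  assumes ge: "\<And>i. i \<in> {1..n} \<Longrightarrow> AE \<omega> in M. - 1 \<le> \<xi> i \<omega>"
    and l: "0 < l" "l < 1"
  defines "p \<equiv> - l - ln (1 - l)"
  shows "prob {\<omega> \<in> space M. \<exists>k\<in>{1..n}. x \<le> partial_sum \<xi> k \<omega> \<and> quad_var \<xi> k \<omega> \<le> w}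
    \<le> exp (p * w - l * x)"
proof -
  define U where "U = (\<lambda>i \<omega>. exp (l * \<xi> i \<omega> - p * (\<xi> i \<omega>)\<^sup>2))"
  define a where "a = exp (l * x - p * w)"
  \<comment> \<open>The sign of \<open>p\<close> serves twice: a small quadratic variation then
    raises the exponent, and the parabola in \<open>bnd\<close> opens downwards.\<close>
  have p: "0 < p"
    using ln_one_minus_le_quadratic[of l] l zero_less_power[OF l(1), of 2]
    unfolding p_def by linarith
  have meas: "U i \<in> borel_measurable (F i)" if "i \<le> n" for i
    using adapted[OF that] unfolding U_def by measurable
  \<comment> \<open>Completing the square: \<open>l^2 / (4 * p)\<close> is the maximum of
    \<open>l * y - p * y^2\<close> over all real \<open>y\<close>, so the factors are bounded
    although the increments have no upper bound.\<close>
  have bnd: "U i \<omega> \<le> exp (l\<^sup>2 / (4 * p))" for i \<omega>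
  proof -
    have "0 \<le> (2 * p * \<xi> i \<omega> - l)\<^sup>2 / (4 * p)" using p by simp
    also have "\<dots> = l\<^sup>2 / (4 * p) - (l * \<xi> i \<omega> - p * (\<xi> i \<omega>)\<^sup>2)"
      using p by (simp add: field_simps power2_eq_square)
    finally show ?thesis by (simp add: U_def)
  qed
  have le: "AE \<omega> in M. U i \<omega> \<le> 1 + l * \<xi> i \<omega>" if "i \<in> {1..n}" for i
    using ge[OF that] by eventually_elim
      (use exp_linear_minus_quadratic_le[OF l] in \<open>simp add: U_def p_def\<close>)
  have prod: "(\<Prod>i = 1..k. U i \<omega>) = exp (l * partial_sum \<xi> k \<omega> - p * quad_var \<xi> k \<omega>)" for k \<omega>
    by (simp add: U_def exp_sum[symmetric] sum_subtractf sum_distrib_left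
        partial_sum_def quad_var_def)
  have "a \<le> (\<Prod>i = 1..k. U i \<omega>)" if "x \<le> partial_sum \<xi> k \<omega>" "quad_var \<xi> k \<omega> \<le> w" for k \<omega>
    unfolding prod a_def exp_le_cancel_iff using that l p
    by (intro diff_mono mult_left_mono) auto
  \<comment> \<open>Monotonicity of the measure asks for measurability of the larger event.\<close>
  moreover have "{\<omega> \<in> space M. \<exists>k\<in>{1..n}. a \<le> (\<Prod>i = 1..k. U i \<omega>)} \<in> sets M"
  proof -
    have [measurable]: "U i \<in> borel_measurable M" if "i \<le> n" for i
      using measurable_from_subalg[OF subalg meas] that by blast
    have [measurable]: "(\<lambda>\<omega>. \<Prod>i = 1..k. U i \<omega>) \<in> borel_measurable M" if "k \<in> {1..n}" for k
      using that by (intro borel_measurable_prod) auto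
    show ?thesis by measurable
  qed
  ultimately have "prob {\<omega> \<in> space M. \<exists>k\<in>{1..n}. x \<le> partial_sum \<xi> k \<omega> \<and> quad_var \<xi> k \<omega> \<le> w}
      \<le> prob {\<omega> \<in> space M. \<exists>k\<in>{1..n}. a \<le> (\<Prod>i = 1..k. U i \<omega>)}"
    by (intro finite_measure_mono) auto
  also have "\<dots> \<le> 1 / a"
    using meas le l bnd
    by (intro ville_maximal_inequality_prod[where l = l and C = "exp (l\<^sup>2 / (4 * p))"]) (auto simp: U_def a_def)
  also have "\<dots> = exp (p * w - l * x)"
    by (simp add: a_def exp_minus[symmetric] inverse_eq_divide[symmetric])
  finally show ?thesis .
qed

end

section \<open>Comparison of the closed-form bounds\<close>

lemma powr_mult_exp_le_B1:
  fixes x v :: real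
  assumes "0 < x" "0 < v"
  shows "(1 + x / v\<^sup>2) powr (v\<^sup>2) * exp (- x) \<le> B1 x 1 v"
proof -
  define y where "y = x / v\<^sup>2"
  \<comment> \<open>After taking logarithms and dividing by \<open>v^2\<close>, the goal is
    \<open>ln (1 + y) - y \<le> - (y^2 / (1 + s + y))\<close>. Writing \<open>y\<close> through
    \<open>s\<close> turns the fraction into \<open>(s - 1)^2 / 2\<close> and leaves
    \<open>ln (1 + y) \<le> s - 1\<close>.\<close>
  define s where "s = sqrt (1 + 2 * y)"
  have y: "0 < y" using assms by (simp add: y_def)
  have x: "x = v\<^sup>2 * y" using assms by (simp add: y_def)
  have s2: "y = (s\<^sup>2 - 1) / 2" using y by (simp add: s_def)
  have s: "1 \<le> s" using y by (simp add: s_def)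
  have "1 + y \<le> exp (s - 1)"
    using exp_lower_Taylor_quadratic[of "s - 1"] s s2 by (simp add: power2_eq_square field_simps)
  then have "ln (1 + y) \<le> s - 1"
    using y by (metis add_pos_pos ln_exp ln_le_cancel_iff exp_gt_zero zero_less_one)
  moreover have "y\<^sup>2 / (1 + s + y) = (s - 1)\<^sup>2 / 2"
  proof -
    have *: "1 + s + y = (s + 1)\<^sup>2 / 2" "y\<^sup>2 = (s - 1)\<^sup>2 * (s + 1)\<^sup>2 / 4"
      unfolding s2 by (simp_all add: power2_eq_square field_simps)
    show ?thesis unfolding * using s by simp
  qed
  moreover have "y - (s - 1)\<^sup>2 / 2 = s - 1"
    unfolding s2 by (simp add: power2_eq_square field_simps)
  ultimately have "ln (1 + y) - y \<le> - (y\<^sup>2 / (1 + s + y))" by simp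
  then have "v\<^sup>2 * (ln (1 + y) - y) \<le> v\<^sup>2 * - (y\<^sup>2 / (1 + s + y))"
    by (intro mult_left_mono) auto
  also have "\<dots> = - (x\<^sup>2 / (v\<^sup>2 * (1 + s) + x))"
  proof -
    have *: "v\<^sup>2 * (1 + s) + x = v\<^sup>2 * (1 + s + y)" "x\<^sup>2 = v\<^sup>2 * (v\<^sup>2 * y\<^sup>2)"
      by (simp_all add: x algebra_simps power2_eq_square)
    show ?thesis unfolding * using assms by (subst mult_divide_mult_cancel_left) auto
  qed
  finally have "exp (v\<^sup>2 * ln (1 + y) - x) \<le> exp (- (x\<^sup>2 / (v\<^sup>2 * (1 + s) + x)))"
    by (simp add: x algebra_simps)
  moreover have "(1 + x / v\<^sup>2) powr (v\<^sup>2) * exp (- x) = exp (v\<^sup>2 * ln (1 + y) - x)"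
    using y by (simp add: y_def[symmetric] powr_def exp_diff exp_minus field_simps)
  ultimately show ?thesis
    by (simp add: B1_def s_def y_def)
qed

text \<open>Only the denominators differ, and \<open>sqrt (1 + 2 * y) \<le> 1 + y\<close> at
  \<open>y = x / v^2\<close> compares them.\<close>

lemma B1_le_B2:
  fixes x v :: real
  assumes "0 < x" "0 < v"
  shows "B1 x 1 v \<le> B2 x 1 v"
proof -
  define y where "y = x / v\<^sup>2"
  have y: "0 < y" using assms by (simp add: y_def)
  have "sqrt (1 + 2 * y) \<le> 1 + y"
    using y by (intro real_le_lsqrt) (auto simp: power2_eq_square algebra_simps)
  then have "v\<^sup>2 * (1 + sqrt (1 + 2 * y)) \<le> v\<^sup>2 * (2 + y)"
    by (intro mult_left_mono) auto
  also have "\<dots> = 2 * v\<^sup>2 + x" using assms by (simp add: y_def field_simps)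
  finally have "v\<^sup>2 * (1 + sqrt (1 + 2 * y)) + x \<le> 2 * (v\<^sup>2 + x)" by simp
  moreover have "0 < v\<^sup>2 * (1 + sqrt (1 + 2 * y)) + x"
    using assms y by (intro add_nonneg_pos) auto
  ultimately have "x\<^sup>2 / (2 * (v\<^sup>2 + x)) \<le> x\<^sup>2 / (v\<^sup>2 * (1 + sqrt (1 + 2 * y)) + x)"
    using assms by (intro divide_left_mono) auto
  then show ?thesis by (simp add: B1_def B2_def y_def)
qed

theorem corollary2p3:
  fixes M :: "'a measure" and F :: "nat \<Rightarrow> 'a measure"
    and \<xi> :: "nat \<Rightarrow> 'a \<Rightarrow> real" and n :: nat and x v :: real
  assumes "n \<ge> 1"
    and "supermartingale_differences M F \<xi> n"
    and "\<And>i. i \<in> {1..n} \<Longrightarrow> AE \<omega> in M. \<xi> i \<omega> \<ge> - 1"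
    and "x > 0" and "v > 0"
  shows "measure M {\<omega> \<in> space M. \<exists>k\<in>{1..n}. partial_sum \<xi> k \<omega> \<ge> x \<and> quad_var \<xi> k \<omega> \<le> v\<^sup>2}
           \<le> (1 + x / v\<^sup>2) powr (v\<^sup>2) * exp (- x)
       \<and> (1 + x / v\<^sup>2) powr (v\<^sup>2) * exp (- x) \<le> B1 x 1 v
       \<and> B1 x 1 v \<le> B2 x 1 v"
proof (intro conjI)
  interpret supermartingale_differences M F \<xi> n by fact
  \<comment> \<open>Setting the derivative in \<open>l\<close> of the exponent
    \<open>(- l - ln (1 - l)) * v^2 - l * x\<close> to zero gives
    \<open>1 / (1 - l) = 1 + x / v^2\<close>, hence this value.\<close>
  define l where "l = x / (v\<^sup>2 + x)"
  have pos: "0 < v\<^sup>2 + x" "0 < 1 + x / v\<^sup>2" using assms by (simp_all add: add_pos_pos)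
  have l: "0 < l" "l < 1" using assms pos by (simp_all add: l_def)
  have "1 - l = inverse (1 + x / v\<^sup>2)"
    using pos assms by (simp add: l_def field_simps)
  then have "ln (1 - l) = - ln (1 + x / v\<^sup>2)"
    using pos by (simp add: ln_inverse)
  moreover have "l * (v\<^sup>2 + x) = x"
    using pos by (simp add: l_def)
  ultimately have "(- l - ln (1 - l)) * v\<^sup>2 - l * x = v\<^sup>2 * ln (1 + x / v\<^sup>2) - x"
    by (simp add: algebra_simps)
  moreover have "exp (v\<^sup>2 * ln (1 + x / v\<^sup>2) - x) = (1 + x / v\<^sup>2) powr (v\<^sup>2) * exp (- x)"
    using pos by (simp add: powr_def exp_diff exp_minus field_simps)
  ultimately show "measure M {\<omega> \<in> space M. \<exists>k\<in>{1..n}. partial_sum \<xi> k \<omega> \<ge> x \<and> quad_var \<xi> k \<omega> \<le> v\<^sup>2}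
      \<le> (1 + x / v\<^sup>2) powr (v\<^sup>2) * exp (- x)"
    using prob_partial_sum_ge_quad_var_le[OF assms(3) l, of x "v\<^sup>2"] by simp
  show "(1 + x / v\<^sup>2) powr (v\<^sup>2) * exp (- x) \<le> B1 x 1 v"
    using powr_mult_exp_le_B1 assms by blast
  show "B1 x 1 v \<le> B2 x 1 v"
    using B1_le_B2 assms by blast
qed

end
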